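(* Let $\mathcal{R}$ be a commutative ring with unity and let $k,l\in\mathbb{N}$. Let $\mathcal{I}_1,\ldots,\mathcal{I}_k$ be mutually co-maximal ideals of $\mathcal{R}$ (i.e. $\mathcal{I}_i+\mathcal{I}_j=\mathcal{R}$ for $i\neq j$), and suppose that either the ideal $\mathcal{I}=\prod_{i=1}^{k}\mathcal{I}_i$ satisfies the unital set condition (USC) or $\mathcal{I}=\mathcal{R}$. Let $m_0,m_1,\ldots,m_l\in\mathbb{N}$. Then the Chinese remainder reduction map \[\mathbb{PF}^{l,(m_0,\ldots,m_l)}_{\mathcal{I}}\longrightarrow \mathbb{PF}^{l,(m_0,\ldots,m_l)}_{\mathcal{I}_1}\times\mathbb{PF}^{l,(m_0,\ldots,m_l)}_{\mathcal{I}_2}\times\cdots\times\mathbb{PF}^{l,(m_0,\ldots,m_l)}_{\mathcal{I}_k},\] sending the class of $(a_0,\ldots,a_l)$ with respect to $\mathcal{I}$ to the tuple of its classes with respect to each $\mathcal{I}_i$, is surjective (in fact bijective).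
   Context: For a commutative ring $\mathcal{R}$ with unity and $l\in\mathbb{N}$, let $\mathcal{GCD}_{l+1}(\mathcal{R})=\{(a_0,\ldots,a_l)\in\mathcal{R}^{l+1}\mid \sum_{i=0}^{l}\langle a_i\rangle=\mathcal{R}\}$. For an ideal $\mathcal{J}\subsetneq\mathcal{R}$ and $m_0,\ldots,m_l\in\mathbb{N}$, define $(a_0,\ldots,a_l)\sim(b_0,\ldots,b_l)$ on $\mathcal{GCD}_{l+1}(\mathcal{R})$ if there exists $\lambda\in\mathcal{R}$ whose image in $\mathcal{R}/\mathcal{J}$ is a unit such that $a_i\equiv\lambda^{m_i}b_i\bmod\mathcal{J}$ for $0\le i\le l$. The generalized projective space $\mathbb{PF}^{l,(m_0,\ldots,m_l)}_{\mathcal{J}}$ is the set of equivalence classes $\mathcal{GCD}_{l+1}(\mathcal{R})/\sim$; its elements are written $[a_0:\cdots:a_l]$. If $\mathcal{J}=\mathcal{R}$, the relation is the trivial one (all elements related) and $\mathbb{PF}^{l,(m_0,\ldots,m_l)}_{\mathcal{R}}$ is a singleton. A finite subset $\{a_1,\ldots,a_n\}\subseteq\mathcal{R}$ (repetitions allowed) is unital if it generates the unit ideal. An ideal $\mathcal{J}\subsetneq\mathcal{R}$ satisfies the unital set condition (USC) if for every $n\ge 2$ and every unital set $\{a_1,\ldots,a_n\}\subseteq\mathcal{R}$ there exists $b\in\langle a_2,\ldots,a_n\rangle$ such that $a_1+b$ is a unit modulo $\mathcal{J}$. *)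

theory Defs
  imports "HOL-Algebra.Ideal_Product" "HOL-Algebra.QuotRing" "HOL-Library.FuncSet"
begin

definition unit_mod :: "('a, 'b) ring_scheme \<Rightarrow> 'a set \<Rightarrow> 'a \<Rightarrow> bool"
  where "unit_mod R J x \<longleftrightarrow> x \<in> carrier R \<and> J +>\<^bsub>R\<^esub> x \<in> Units (R Quot J)"

text \<open>Tuples \<open>(a\<^sub>0, \<dots>, a\<^sub>l)\<close> are extensional functions on \<open>{0..l}\<close>; the sum of the principal
  ideals is taken in the semiring of ideals of \<open>R\<close>.\<close>

definition GCD_tuples :: "('a, 'b) ring_scheme \<Rightarrow> nat \<Rightarrow> (nat \<Rightarrow> 'a) set"
  where "GCD_tuples R l =
    {a \<in> {0..l} \<rightarrow>\<^sub>E carrier R. (\<Oplus>\<^bsub>ideals_set R\<^esub>i\<in>{0..l}. PIdl\<^bsub>R\<^esub> (a i)) = carrier R}"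

definition PF_rel ::
    "('a, 'b) ring_scheme \<Rightarrow> 'a set \<Rightarrow> nat \<Rightarrow> (nat \<Rightarrow> nat) \<Rightarrow> ((nat \<Rightarrow> 'a) \<times> (nat \<Rightarrow> 'a)) set"
  where "PF_rel R J l m =
    (if J = carrier R then GCD_tuples R l \<times> GCD_tuples R l
     else {(a, b) \<in> GCD_tuples R l \<times> GCD_tuples R l.
       \<exists>c. unit_mod R J c \<and>
         (\<forall>i\<in>{0..l}. a i \<ominus>\<^bsub>R\<^esub> ((c [^]\<^bsub>R\<^esub> m i) \<otimes>\<^bsub>R\<^esub> b i) \<in> J)})"

definition PF ::
    "('a, 'b) ring_scheme \<Rightarrow> 'a set \<Rightarrow> nat \<Rightarrow> (nat \<Rightarrow> nat) \<Rightarrow> (nat \<Rightarrow> 'a) set set"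
  where "PF R J l m = GCD_tuples R l // PF_rel R J l m"

definition PF_class ::
    "('a, 'b) ring_scheme \<Rightarrow> 'a set \<Rightarrow> nat \<Rightarrow> (nat \<Rightarrow> nat) \<Rightarrow> (nat \<Rightarrow> 'a) \<Rightarrow> (nat \<Rightarrow> 'a) set"
  where "PF_class R J l m a = PF_rel R J l m `` {a}"

definition unital_set_condition :: "('a, 'b) ring_scheme \<Rightarrow> 'a set \<Rightarrow> bool"
  where "unital_set_condition R J \<longleftrightarrow>
    ideal J R \<and> J \<noteq> carrier R \<and>
    (\<forall>n\<ge>2. \<forall>a\<in>{1..n} \<rightarrow> carrier R. Idl\<^bsub>R\<^esub> (a ` {1..n}) = carrier R \<longrightarrow>
       (\<exists>b\<in>Idl\<^bsub>R\<^esub> (a ` {2..n}). unit_mod R J (a (1::nat) \<oplus>\<^bsub>R\<^esub> b)))"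

definition ideal_product :: "('a, 'b) ring_scheme \<Rightarrow> (nat \<Rightarrow> 'a set) \<Rightarrow> nat \<Rightarrow> 'a set"
  where "ideal_product R I k = (\<Otimes>\<^bsub>ideals_set R\<^esub>j\<in>{1..k}. I j)"

text \<open>The component at \<open>j\<close> of the image of a class \<open>C\<close> is the common value of
  \<open>PF_class R (I j) l m a\<close> over all representatives \<open>a \<in> C\<close>. It is unspecified if this value
  depends on the representative, so well-definedness has to be asserted separately.\<close>

definition CRT_reduction ::
    "('a, 'b) ring_scheme \<Rightarrow> (nat \<Rightarrow> 'a set) \<Rightarrow> nat \<Rightarrow> nat \<Rightarrow> (nat \<Rightarrow> nat) \<Rightarrow>
     (nat \<Rightarrow> 'a) set \<Rightarrow> (nat \<Rightarrow> (nat \<Rightarrow> 'a) set)"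
  where "CRT_reduction R I k l m =
    (\<lambda>C\<in>PF R (ideal_product R I k) l m. \<lambda>j\<in>{1..k}. the_elem (PF_class R (I j) l m ` C))"

end

theory Submission
  imports Defs
begin

text \<open>The class of a tuple modulo \<open>\<I>\<close> is determined by its classes modulo the \<open>\<I>\<^sub>j\<close> because the scalars
  and their inverses can be glued by the Chinese remainder theorem and \<open>\<I> = \<Inter>\<^sub>j \<I>\<^sub>j\<close>. For surjectivity,
  gluing representatives coordinatewise gives a tuple \<open>b\<close> with \<open>\<langle>b\<^sub>0, \<dots>, b\<^sub>l\<rangle> + \<I> = \<R>\<close>, and the unital set
  condition allows \<open>b\<close> to be changed within its class modulo \<open>\<I>\<close> into a tuple that generates \<open>\<R>\<close>.\<close>

context cring
begin

section \<open>Sums of ideals and ideals generated by finite sets\<close>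

lemma set_addI: "x \<in> A \<Longrightarrow> y \<in> B \<Longrightarrow> z = x \<oplus> y \<Longrightarrow> z \<in> A <+> B"
  unfolding set_add_def' by blast

lemma set_addE:
  fixes z :: 'a
  assumes "z \<in> A <+> B"
  obtains x y where "x \<in> A" "y \<in> B" "z = x \<oplus> y"
  using assms unfolding set_add_def' by blast

lemma comaximal_iff:
  assumes "ideal I R" "ideal J R"
  shows "I <+> J = carrier R \<longleftrightarrow> (\<exists>x\<in>I. \<exists>y\<in>J. \<one> = x \<oplus> y)"
proof
  assume "I <+> J = carrier R"
  then show "\<exists>x\<in>I. \<exists>y\<in>J. \<one> = x \<oplus> y"
    using one_closed by (metis set_addE)
next
  assume "\<exists>x\<in>I. \<exists>y\<in>J. \<one> = x \<oplus> y"
  then have "\<one> \<in> I <+> J"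
    by (blast intro: set_addI)
  then show "I <+> J = carrier R"
    using ideal.one_imp_carrier[OF add_ideals[OF assms]] by blast
qed

text \<open>By \<open>union_genideal\<close> the sum of two ideals is generated by their union, so
  it suffices that \<open>insert x S\<close> and \<open>PIdl x \<union> Idl S\<close> generate the
  same ideal; each lies in the ideal generated by the other.\<close>

lemma genideal_insert:
  assumes "x \<in> carrier R" "S \<subseteq> carrier R"
  shows "Idl (insert x S) = PIdl x <+> Idl S"
proof -
  have ids: "ideal (PIdl x) R" "ideal (Idl S) R" "ideal (Idl (insert x S)) R"
    using assms by (auto intro: cgenideal_ideal genideal_ideal)
  have sub: "insert x S \<subseteq> Idl (insert x S)"
    using assms by (intro genideal_self) auto
  have "Idl (insert x S) = Idl (PIdl x \<union> Idl S)"
  proof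
    have "insert x S \<subseteq> PIdl x \<union> Idl S"
      using cgenideal_self[OF assms(1)] genideal_self[OF assms(2)] by blast
    then show "Idl (insert x S) \<subseteq> Idl (PIdl x \<union> Idl S)"
      using ids by (intro subset_Idl_subset) (auto dest: ideal.Icarr)
    have "PIdl x \<subseteq> Idl (insert x S)" "Idl S \<subseteq> Idl (insert x S)"
      using sub ids by (auto intro!: cgenideal_minimal genideal_minimal del: subsetI)
    then show "Idl (PIdl x \<union> Idl S) \<subseteq> Idl (insert x S)"
      using ids by (intro genideal_minimal) auto
  qed
  then show ?thesis
    using union_genideal ids by simp
qed

lemma genideal_empty: "Idl {} = {\<zero>}"
proof
  show "Idl {} \<subseteq> {\<zero>}"
    by (intro genideal_minimal zeroideal) simp
  show "{\<zero>} \<subseteq> Idl {}"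
    using additive_subgroup.zero_closed[OF ideal.axioms(1)[OF genideal_ideal[of "{}"]]] by simp
qed

text \<open>Replaces the sum in the semiring of ideals by a generated ideal, for which minimality
  arguments and the unital set condition are directly available. Induction on the index set adds one
  generator at a time.\<close>

lemma finsum_cgenideal:
  assumes "finite A" "a \<in> A \<rightarrow> carrier R"
  shows "(\<Oplus>\<^bsub>ideals_set R\<^esub>i\<in>A. PIdl (a i)) = Idl (a ` A)"
proof -
  interpret S: semiring "ideals_set R"
    by (rule ideals_set_is_semiring)
  show ?thesis
    using assms
  proof (induction A rule: finite_induct)
    case empty
    then show ?case
      by (simp add: genideal_empty) (simp add: ideals_set_def)
  next
    case (insert x F)
    then have "(\<lambda>i. PIdl (a i)) \<in> F \<rightarrow> carrier (ideals_set R)" "PIdl (a x) \<in> carrier (ideals_set R)"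
      by (auto simp: ideals_set_def intro: cgenideal_ideal)
    then have "(\<Oplus>\<^bsub>ideals_set R\<^esub>i\<in>insert x F. PIdl (a i)) = PIdl (a x) \<oplus>\<^bsub>ideals_set R\<^esub> Idl (a ` F)"
      using insert by simp
    also have "\<dots> = Idl (a ` insert x F)"
      using genideal_insert[of "a x" "a ` F"] insert.prems by (auto simp: ideals_set_def)
    finally show ?case .
  qed
qed

section \<open>Unital tuples, units modulo an ideal and the scaling relation\<close>

lemma GCD_tuples_iff:
  "a \<in> GCD_tuples R l \<longleftrightarrow> a \<in> {0..l} \<rightarrow>\<^sub>E carrier R \<and> Idl (a ` {0..l}) = carrier R"
  unfolding GCD_tuples_def using finsum_cgenideal[of "{0..l}" a] by auto

lemma GCD_tuples_closed: "a \<in> GCD_tuples R l \<Longrightarrow> i \<in> {0..l} \<Longrightarrow> a i \<in> carrier R"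
  by (auto simp: GCD_tuples_iff)

text \<open>Lifting an inverse from the quotient to \<open>R\<close> gives an explicit witness
  \<open>d\<close>. Such witnesses can be carried to larger ideals and glued across several
  ideals.\<close>

lemma unit_mod_iff:
  assumes "ideal J R"
  shows "unit_mod R J c \<longleftrightarrow> c \<in> carrier R \<and> (\<exists>d\<in>carrier R. c \<otimes> d \<ominus> \<one> \<in> J)"
proof -
  interpret J: ideal J R by fact
  interpret Q: cring "R Quot J"
    using J.quotient_is_cring is_cring .
  have carr: "carrier (R Quot J) = (+>) J ` carrier R"
    by (auto simp: FactRing_def A_RCOSETS_def')
  have "J +> c \<in> Units (R Quot J) \<longleftrightarrow> (\<exists>d\<in>carrier R. c \<otimes> d \<ominus> \<one> \<in> J)"
    if c: "c \<in> carrier R"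
  proof -
    have eq: "c \<otimes> d \<ominus> \<one> \<in> J \<longleftrightarrow> (J +> c) \<otimes>\<^bsub>R Quot J\<^esub> (J +> d) = \<one>\<^bsub>R Quot J\<^esub>"
      if "d \<in> carrier R" for d
      using c that quotient_eq_iff_same_a_r_cos[OF assms, of "c \<otimes> d" \<one>]
      by (simp add: FactRing_def J.rcoset_mult_add)
    \<comment> \<open>The quotient is commutative, so a one-sided inverse is enough.\<close>
    have "J +> c \<in> Units (R Quot J) \<longleftrightarrow>
        (\<exists>D\<in>carrier (R Quot J). (J +> c) \<otimes>\<^bsub>R Quot J\<^esub> D = \<one>\<^bsub>R Quot J\<^esub>)"
    proof
      assume "\<exists>D\<in>carrier (R Quot J). (J +> c) \<otimes>\<^bsub>R Quot J\<^esub> D = \<one>\<^bsub>R Quot J\<^esub>"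
      then obtain D where "D \<in> carrier (R Quot J)" "(J +> c) \<otimes>\<^bsub>R Quot J\<^esub> D = \<one>\<^bsub>R Quot J\<^esub>"
        by blast
      moreover have "J +> c \<in> carrier (R Quot J)"
        using c carr by blast
      ultimately show "J +> c \<in> Units (R Quot J)"
        using Q.m_comm unfolding Units_def by auto
    qed (use Q.Units_r_inv_ex in blast)
    then show ?thesis
      using carr eq by auto
  qed
  then show ?thesis
    unfolding unit_mod_def by blast
qed

text \<open>For \<open>J = carrier R\<close> the scalars \<open>c = d = \<one>\<close> satisfy every
  condition trivially, so this one formula covers the improper ideal as well and later proofs avoid
  the case distinction.\<close>

lemma PF_rel_iff:
  assumes "ideal J R"
  shows "(a, b) \<in> PF_rel R J l m \<longleftrightarrow> a \<in> GCD_tuples R l \<and> b \<in> GCD_tuples R l \<and>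
    (\<exists>c\<in>carrier R. \<exists>d\<in>carrier R. c \<otimes> d \<ominus> \<one> \<in> J \<and>
      (\<forall>i\<in>{0..l}. a i \<ominus> c [^] m i \<otimes> b i \<in> J))"
proof (cases "J = carrier R")
  case True
  have "a i \<ominus> \<one> [^] m i \<otimes> b i \<in> carrier R"
    if "a \<in> GCD_tuples R l" "b \<in> GCD_tuples R l" "i \<in> {0..l}" for i
    using that GCD_tuples_closed by simp
  then show ?thesis
    using True unfolding PF_rel_def by (auto intro!: bexI[of _ \<one>])
next
  case False
  then show ?thesis
    unfolding PF_rel_def using unit_mod_iff[OF assms] by auto
qed

lemma coset_mult_cong:
  assumes "ideal J R" "J +> x = J +> x'" "J +> y = J +> y'"
    and "x \<in> carrier R" "x' \<in> carrier R" "y \<in> carrier R" "y' \<in> carrier R"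
  shows "J +> x \<otimes> y = J +> x' \<otimes> y'"
  using assms ideal.rcoset_mult_add[OF assms(1)] by metis

lemma coset_pow_cong:
  assumes "ideal J R" "J +> x = J +> x'" "x \<in> carrier R" "x' \<in> carrier R"
  shows "J +> x [^] (n::nat) = J +> x' [^] n"
proof (induction n)
  case (Suc n)
  then show ?case
    using coset_mult_cong[OF assms(1) Suc assms(2)] assms(3,4) by simp
qed simp

lemma coset_eq_mono:
  assumes "ideal J R" "ideal K R" "J \<subseteq> K" "J +> x = J +> y" "x \<in> carrier R" "y \<in> carrier R"
  shows "K +> x = K +> y"
  using assms quotient_eq_iff_same_a_r_cos by blast

text \<open>Coset equations can be chained by transitivity and multiplied by
  \<open>coset_mult_cong\<close>, which makes calculations shorter than with differences lying in
  \<open>J\<close>.\<close>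

lemma PF_rel_iff_coset:
  assumes "ideal J R"
  shows "(a, b) \<in> PF_rel R J l m \<longleftrightarrow> a \<in> GCD_tuples R l \<and> b \<in> GCD_tuples R l \<and>
    (\<exists>c\<in>carrier R. \<exists>d\<in>carrier R. J +> c \<otimes> d = J +> \<one> \<and>
      (\<forall>i\<in>{0..l}. J +> a i = J +> c [^] m i \<otimes> b i))"
proof (cases "a \<in> GCD_tuples R l \<and> b \<in> GCD_tuples R l")
  case True
  then have "a i \<ominus> c [^] m i \<otimes> b i \<in> J \<longleftrightarrow> J +> a i = J +> c [^] m i \<otimes> b i"
    if "c \<in> carrier R" "i \<in> {0..l}" for c i
    using that GCD_tuples_closed by (intro quotient_eq_iff_same_a_r_cos[OF assms]) auto
  moreover have "c \<otimes> d \<ominus> \<one> \<in> J \<longleftrightarrow> J +> c \<otimes> d = J +> \<one>"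
    if "c \<in> carrier R" "d \<in> carrier R" for c d
    using that by (intro quotient_eq_iff_same_a_r_cos[OF assms]) auto
  ultimately show ?thesis
    unfolding PF_rel_iff[OF assms] by (simp cong: bex_cong ball_cong del: atLeastAtMost_iff)
qed (auto simp: PF_rel_iff[OF assms])

text \<open>The scalar \<open>\<one>\<close> gives reflexivity. For symmetry the inverse
  \<open>d\<close> serves as scalar, because \<open>(c \<otimes> d) [^] m i\<close> is congruent to
  \<open>\<one>\<close>. For transitivity the scalars are multiplied, and so are their
  inverses.\<close>

lemma equiv_PF_rel:
  assumes J: "ideal J R"
  shows "equiv (GCD_tuples R l) (PF_rel R J l m)"
proof (rule equivI)
  show "PF_rel R J l m \<subseteq> GCD_tuples R l \<times> GCD_tuples R l"
    using PF_rel_iff[OF J] by auto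
  show "refl_on (GCD_tuples R l) (PF_rel R J l m)"
    using GCD_tuples_closed
    by (intro refl_onI) (auto simp: PF_rel_iff_coset[OF J] intro!: bexI[of _ \<one>])
  show "sym (PF_rel R J l m)"
  proof (rule symI)
    fix a b
    assume "(a, b) \<in> PF_rel R J l m"
    then obtain c d where ab: "a \<in> GCD_tuples R l" "b \<in> GCD_tuples R l"
      and cd: "c \<in> carrier R" "d \<in> carrier R" "J +> c \<otimes> d = J +> \<one>"
      and eq: "\<And>i. i \<in> {0..l} \<Longrightarrow> J +> a i = J +> c [^] m i \<otimes> b i"
      unfolding PF_rel_iff_coset[OF J] by blast
    have "J +> b i = J +> d [^] m i \<otimes> a i" if i: "i \<in> {0..l}" for i
    proof -
      have carr: "a i \<in> carrier R" "b i \<in> carrier R"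
        using ab i GCD_tuples_closed by auto
      have "J +> d [^] m i \<otimes> a i = J +> d [^] m i \<otimes> (c [^] m i \<otimes> b i)"
        using carr cd eq[OF i] by (intro coset_mult_cong[OF J]) auto
      also have "d [^] m i \<otimes> (c [^] m i \<otimes> b i) = (c \<otimes> d) [^] m i \<otimes> b i"
        using carr cd by (simp add: nat_pow_distrib m_ac)
      also have "J +> \<dots> = J +> \<one> [^] m i \<otimes> b i"
        using carr cd by (intro coset_mult_cong[OF J] coset_pow_cong[OF J]) auto
      finally show ?thesis
        using carr by simp
    qed
    then show "(b, a) \<in> PF_rel R J l m"
      unfolding PF_rel_iff_coset[OF J] using ab cd m_comm by metis
  qed
  show "trans (PF_rel R J l m)"
  proof (rule transI)
    fix a b e
    assume "(a, b) \<in> PF_rel R J l m" "(b, e) \<in> PF_rel R J l m"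
    then have abe: "a \<in> GCD_tuples R l" "b \<in> GCD_tuples R l" "e \<in> GCD_tuples R l"
      unfolding PF_rel_iff_coset[OF J] by simp_all
    obtain c d where cd: "c \<in> carrier R" "d \<in> carrier R" "J +> c \<otimes> d = J +> \<one>"
      and eq: "\<And>i. i \<in> {0..l} \<Longrightarrow> J +> a i = J +> c [^] m i \<otimes> b i"
      using \<open>(a, b) \<in> PF_rel R J l m\<close> unfolding PF_rel_iff_coset[OF J] by blast
    obtain c' d' where cd': "c' \<in> carrier R" "d' \<in> carrier R" "J +> c' \<otimes> d' = J +> \<one>"
      and eq': "\<And>i. i \<in> {0..l} \<Longrightarrow> J +> b i = J +> c' [^] m i \<otimes> e i"
      using \<open>(b, e) \<in> PF_rel R J l m\<close> unfolding PF_rel_iff_coset[OF J] by blast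
    have "J +> a i = J +> (c \<otimes> c') [^] m i \<otimes> e i" if i: "i \<in> {0..l}" for i
    proof -
      have carr: "a i \<in> carrier R" "b i \<in> carrier R" "e i \<in> carrier R"
        using abe i GCD_tuples_closed by auto
      have "J +> a i = J +> c [^] m i \<otimes> b i"
        using eq i .
      also have "\<dots> = J +> c [^] m i \<otimes> (c' [^] m i \<otimes> e i)"
        using carr cd cd' eq'[OF i] by (intro coset_mult_cong[OF J]) auto
      also have "c [^] m i \<otimes> (c' [^] m i \<otimes> e i) = (c \<otimes> c') [^] m i \<otimes> e i"
        using carr cd cd' by (simp add: nat_pow_distrib m_ac)
      finally show ?thesis .
    qed
    moreover have "J +> (c \<otimes> c') \<otimes> (d \<otimes> d') = J +> \<one>"
      using coset_mult_cong[OF J cd(3) cd'(3)] cd cd' by (simp add: m_ac)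
    ultimately show "(a, e) \<in> PF_rel R J l m"
      unfolding PF_rel_iff_coset[OF J] using abe cd cd' by blast
  qed
qed

section \<open>Products of comaximal ideals and the Chinese remainder theorem\<close>

lemma ideal_finprod:
  assumes "\<And>j. j \<in> A \<Longrightarrow> ideal (I j) R"
  shows "ideal (\<Otimes>\<^bsub>ideals_set R\<^esub>j\<in>A. I j) R"
proof -
  interpret S: comm_monoid "ideals_set R"
    by (rule ideals_set_is_comm_monoid)
  show ?thesis
    using S.finprod_closed[of I A] assms by (auto simp: ideals_set_def)
qed

lemma finprod_ideals_insert:
  assumes "finite A" "j \<notin> A" "\<And>i. i \<in> insert j A \<Longrightarrow> ideal (I i) R"
  shows "(\<Otimes>\<^bsub>ideals_set R\<^esub>i\<in>insert j A. I i) = I j \<cdot> (\<Otimes>\<^bsub>ideals_set R\<^esub>i\<in>A. I i)"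
proof -
  interpret S: comm_monoid "ideals_set R"
    by (rule ideals_set_is_comm_monoid)
  have "I \<in> A \<rightarrow> carrier (ideals_set R)" "I j \<in> carrier (ideals_set R)"
    using assms by (auto simp: ideals_set_def)
  from S.finprod_insert[OF assms(1,2) this] show ?thesis
    by (simp add: ideals_set_def)
qed

lemma finprod_ideals_empty: "(\<Otimes>\<^bsub>ideals_set R\<^esub>i\<in>{}. I i) = carrier R"
proof -
  interpret S: comm_monoid "ideals_set R"
    by (rule ideals_set_is_comm_monoid)
  show ?thesis
    by (simp only: S.finprod_empty) (simp add: ideals_set_def)
qed

text \<open>Multiply \<open>\<one> = x \<oplus> y\<close> and \<open>\<one> = x' \<oplus> p\<close>,
  where \<open>x\<close> and \<open>x'\<close> lie in \<open>J\<close>, \<open>y\<close> in the new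
  factor and \<open>p\<close> in the product of the others: every term of the expansion except
  \<open>y \<otimes> p\<close> lies in \<open>J\<close>.\<close>

lemma comaximal_finprod:
  assumes "finite A" "ideal J R"
    and "\<And>j. j \<in> A \<Longrightarrow> ideal (I j) R"
    and "\<And>j. j \<in> A \<Longrightarrow> J <+> I j = carrier R"
  shows "J <+> (\<Otimes>\<^bsub>ideals_set R\<^esub>j\<in>A. I j) = carrier R"
  using assms
proof (induction A rule: finite_induct)
  case empty
  interpret J: ideal J R by fact
  have "\<one> = \<zero> \<oplus> \<one>" "\<zero> \<in> J"
    by auto
  then show ?case
    unfolding finprod_ideals_empty comaximal_iff[OF \<open>ideal J R\<close> oneideal] by blast
next
  case (insert j A)
  interpret J: ideal J R by fact
  let ?P = "\<Otimes>\<^bsub>ideals_set R\<^esub>j\<in>A. I j"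
  have Ij: "ideal (I j) R" and P: "ideal ?P R" and IP: "ideal (I j \<cdot> ?P) R"
    using insert.prems by (simp_all add: ideal_finprod ideal_prod_is_ideal)
  obtain x y where xy: "x \<in> J" "y \<in> I j" "\<one> = x \<oplus> y"
    using insert.prems comaximal_iff[OF insert.prems(1) Ij] by auto
  obtain x' p where xp: "x' \<in> J" "p \<in> ?P" "\<one> = x' \<oplus> p"
    using insert comaximal_iff[OF insert.prems(1) P] by auto
  have carr: "x \<in> carrier R" "y \<in> carrier R" "x' \<in> carrier R" "p \<in> carrier R"
    using xy xp Ij P by (auto dest: ideal.Icarr)
  have "\<one> = (x \<oplus> y) \<otimes> (x' \<oplus> p)"
    using xy xp by (metis l_one one_closed)
  also have "\<dots> = (x \<otimes> (x' \<oplus> p) \<oplus> y \<otimes> x') \<oplus> y \<otimes> p"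
    using carr by algebra
  finally have "\<one> = (x \<otimes> (x' \<oplus> p) \<oplus> y \<otimes> x') \<oplus> y \<otimes> p" .
  moreover have "x \<otimes> (x' \<oplus> p) \<oplus> y \<otimes> x' \<in> J"
    using carr xy xp by (intro J.a_closed J.I_l_closed J.I_r_closed) auto
  moreover have "y \<otimes> p \<in> I j \<cdot> ?P"
    using xy xp by (auto intro: ideal_prod.prod)
  ultimately have "J <+> I j \<cdot> ?P = carrier R"
    unfolding comaximal_iff[OF insert.prems(1) IP] by blast
  then show ?case
    using finprod_ideals_insert[OF insert.hyps insert.prems(2)] by simp
qed

text \<open>Each factor is comaximal with the product of the others, and for two comaximal ideals
  product and intersection agree. The conjunct \<open>x \<in> carrier R\<close> accounts for empty
  \<open>A\<close>, where the product is the whole ring.\<close>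

lemma mem_finprod_comaximal_iff:
  assumes "finite A"
    and "\<And>j. j \<in> A \<Longrightarrow> ideal (I j) R"
    and "\<And>i j. i \<in> A \<Longrightarrow> j \<in> A \<Longrightarrow> i \<noteq> j \<Longrightarrow> I i <+> I j = carrier R"
  shows "x \<in> (\<Otimes>\<^bsub>ideals_set R\<^esub>j\<in>A. I j) \<longleftrightarrow> x \<in> carrier R \<and> (\<forall>j\<in>A. x \<in> I j)"
  using assms
proof (induction A rule: finite_induct)
  case empty
  then show ?case
    unfolding finprod_ideals_empty by simp
next
  case (insert j A)
  let ?P = "\<Otimes>\<^bsub>ideals_set R\<^esub>j\<in>A. I j"
  have Ij: "ideal (I j) R" and P: "ideal ?P R"
    using insert.prems by (simp_all add: ideal_finprod)
  have "I j <+> ?P = carrier R"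
    using insert.hyps insert.prems by (intro comaximal_finprod) auto
  then have "I j \<cdot> ?P = I j \<inter> ?P"
    using ideal_prod_eq_inter Ij P by simp
  then show ?case
    using finprod_ideals_insert[of A j I] insert ideal.Icarr[OF Ij] by auto
qed

lemma chinese_remainder_finite:
  assumes "finite A"
    and "\<And>j. j \<in> A \<Longrightarrow> ideal (I j) R"
    and "\<And>i j. i \<in> A \<Longrightarrow> j \<in> A \<Longrightarrow> i \<noteq> j \<Longrightarrow> I i <+> I j = carrier R"
    and "\<And>j. j \<in> A \<Longrightarrow> x j \<in> carrier R"
  shows "\<exists>z\<in>carrier R. \<forall>j\<in>A. I j +> z = I j +> x j"
  using assms
proof (induction A rule: finite_induct)
  case empty
  then show ?case
    by auto
next
  case (insert j A)
  let ?P = "\<Otimes>\<^bsub>ideals_set R\<^esub>j\<in>A. I j"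
  have Ij: "ideal (I j) R" and P: "ideal ?P R"
    using insert.prems by (simp_all add: ideal_finprod)
  have "\<exists>z\<in>carrier R. \<forall>j\<in>A. I j +> z = I j +> x j"
    using insert.prems by (intro insert.IH) auto
  then obtain z where z: "z \<in> carrier R" "\<And>i. i \<in> A \<Longrightarrow> I i +> z = I i +> x i"
    by blast
  have "I j <+> ?P = carrier R"
    using insert.hyps insert.prems by (intro comaximal_finprod) auto
  then obtain y p where yp: "y \<in> I j" "p \<in> ?P" "\<one> = y \<oplus> p"
    using comaximal_iff[OF Ij P] by auto
  have carr: "y \<in> carrier R" "p \<in> carrier R" "x j \<in> carrier R"
    using yp Ij P insert.prems by (auto dest: ideal.Icarr)
  \<comment> \<open>Since \<open>y \<in> I j\<close>, the element \<open>p\<close> is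
    \<open>1\<close> modulo \<open>I j\<close>, so \<open>w\<close> is congruent to
    \<open>x j\<close> there. Since \<open>p\<close> lies in every earlier \<open>I i\<close>, the
    element \<open>y\<close> is \<open>1\<close> modulo \<open>I i\<close>, so \<open>w\<close> is
    congruent to \<open>z\<close> there.\<close>
  define w where "w = x j \<otimes> p \<oplus> z \<otimes> y"
  have w: "w \<in> carrier R"
    using carr z by (simp add: w_def)
  have p_eq: "p = \<one> \<ominus> y"
    using yp(3) carr by algebra
  have "w \<ominus> x j = (z \<ominus> x j) \<otimes> y"
    unfolding w_def p_eq using carr z(1) by algebra
  then have "w \<ominus> x j \<in> I j"
    using carr z yp ideal.I_l_closed[OF Ij] by simp
  then have "I j +> w = I j +> x j"
    using quotient_eq_iff_same_a_r_cos Ij w carr by blast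
  moreover have "I i +> w = I i +> x i" if i: "i \<in> A" for i
  proof -
    have Ii: "ideal (I i) R"
      using i insert.prems by blast
    have y_eq: "y = \<one> \<ominus> p"
      using yp(3) carr by algebra
    have "w \<ominus> z = (x j \<ominus> z) \<otimes> p"
      unfolding w_def y_eq using carr z(1) by algebra
    moreover have "p \<in> I i"
      using mem_finprod_comaximal_iff[of A I p] insert yp i by auto
    ultimately have "w \<ominus> z \<in> I i"
      using carr z ideal.I_l_closed[OF Ii] by simp
    then show ?thesis
      using quotient_eq_iff_same_a_r_cos Ii w z i by metis
  qed
  ultimately show ?case
    using w by blast
qed

section \<open>The unital set condition and lifting to unital tuples\<close>

text \<open>The condition is stated for families indexed by \<open>{1..n}\<close>; enumerating
  \<open>S\<close> makes it usable for a distinguished element \<open>x\<close> and a finite set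
  \<open>S\<close>. Nonemptiness of \<open>S\<close> yields \<open>n \<ge> 2\<close>.\<close>

lemma unital_set_conditionD:
  assumes "unital_set_condition R J" "x \<in> carrier R" "finite S" "S \<noteq> {}" "S \<subseteq> carrier R"
    and "Idl (insert x S) = carrier R"
  shows "\<exists>b\<in>Idl S. unit_mod R J (x \<oplus> b)"
proof -
  obtain h where h: "bij_betw h {0..<card S} S"
    using ex_bij_betw_nat_finite[OF assms(3)] by blast
  \<comment> \<open>The distinguished element gets index 1. The enumeration \<open>h\<close> starts
    at 0 while the remaining entries start at index 2, hence the shift by 2.\<close>
  define f where "f i = (if i = 1 then x else h (i - 2))" for i :: nat
  define n where "n = card S + 1"
  have n: "n \<ge> 2"
    using assms(3,4) by (simp add: n_def Suc_leI card_gt_0_iff)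
  have shift: "{2..n} = (\<lambda>i. i + 2) ` {0..<card S}"
  proof (intro equalityI subsetI)
    fix i
    assume "i \<in> {2..n}"
    then show "i \<in> (\<lambda>i. i + 2) ` {0..<card S}"
      by (intro image_eqI[of _ _ "i - 2"]) (auto simp: n_def)
  qed (auto simp: n_def)
  have "f ` {2..n} = h ` {0..<card S}"
    unfolding shift image_image by (auto simp: f_def)
  then have f2: "f ` {2..n} = S"
    using h by (simp add: bij_betw_def)
  have "{1..n} = insert 1 {2..n}"
    using n by auto
  then have f1: "f ` {1..n} = insert x S"
    using f2 by (metis f_def image_insert)
  then have "f ` {1..n} \<subseteq> carrier R"
    using assms(2,5) by simp
  then have f_mem: "f \<in> {1..n} \<rightarrow> carrier R"
    by (simp only: image_subset_iff_funcset)
  have usc: "\<forall>n\<ge>2::nat. \<forall>a\<in>{1..n} \<rightarrow> carrier R. Idl (a ` {1..n}) = carrier R \<longrightarrow>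
      (\<exists>b\<in>Idl (a ` {2..n}). unit_mod R J (a 1 \<oplus> b))"
    using assms(1) unfolding unital_set_condition_def by (elim conjE)
  have "\<exists>b\<in>Idl (f ` {2..n}). unit_mod R J (f 1 \<oplus> b)"
    by (rule mp[OF bspec[OF mp[OF spec[OF usc] n] f_mem]]) (simp only: f1 assms(6))
  then show ?thesis
    unfolding f2 by (simp add: f_def)
qed

text \<open>If \<open>u = b\<^sub>0 + r b\<^sub>1 + c\<close> with \<open>c \<in> \<langle>b\<^sub>2, \<dots>, b\<^sub>l\<rangle>\<close> is a unit modulo \<open>J\<close>, say \<open>u v = 1 - t\<close> with
  \<open>t \<in> J\<close>, then moving \<open>b\<^sub>1\<close> to \<open>b\<^sub>1 + (1 - b\<^sub>1) t\<close>, which is \<open>1\<close> modulo \<open>u\<close>, and compensating in \<open>b\<^sub>0\<close>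
  so that \<open>u\<close> stays in the ideal of the tuple makes the tuple unital.\<close>

lemma lift_unital_tuple:
  assumes usc: "unital_set_condition R J" and l: "l \<ge> 1"
    and b: "\<And>i. i \<in> {0..l} \<Longrightarrow> b i \<in> carrier R"
    and comax: "Idl (b ` {0..l}) <+> J = carrier R"
  shows "\<exists>a\<in>GCD_tuples R l. \<forall>i\<in>{0..l}. J +> a i = J +> b i"
proof -
  have J: "ideal J R"
    using usc by (simp add: unital_set_condition_def)
  interpret J: ideal J R by fact
  have b_sub: "b ` {0..l} \<subseteq> carrier R"
    using b by blast
  obtain g e where ge: "g \<in> Idl (b ` {0..l})" "e \<in> J" "\<one> = g \<oplus> e"
    using comax comaximal_iff[OF genideal_ideal[OF b_sub] J] by blast
  define S where "S = b ` {2..l}"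
  have S: "S \<subseteq> carrier R"
    using b by (auto simp: S_def)
  have b0: "b 0 \<in> carrier R" and b1: "b 1 \<in> carrier R" and e: "e \<in> carrier R"
    using b l ge(2) by auto
  have "{0..l} = insert 0 (insert 1 {2..l})"
    using l by auto
  then have img: "b ` {0..l} = insert (b 0) (insert (b 1) S)"
    by (simp add: S_def)
  \<comment> \<open>The entries of \<open>b\<close> generate \<open>\<one>\<close> only up to
    \<open>e \<in> J\<close>. Adding \<open>e\<close> itself as a generator makes the set unital, so
    that the condition applies with \<open>b 0\<close> as the distinguished element.\<close>
  let ?T = "insert e (insert (b 1) S)"
  have T: "ideal (Idl (insert (b 0) ?T)) R" "insert (b 0) ?T \<subseteq> Idl (insert (b 0) ?T)"
    using genideal_ideal[of "insert (b 0) ?T"] genideal_self[of "insert (b 0) ?T"] b0 b1 e S by auto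
  interpret T: ideal "Idl (insert (b 0) ?T)" R by (fact T)
  have "g \<in> Idl (insert (b 0) ?T)"
    using ge(1) genideal_minimal[OF T(1), of "b ` {0..l}"] T(2) img by auto
  then have "\<one> \<in> Idl (insert (b 0) ?T)"
    unfolding ge(3) using T(2) by (intro T.a_closed) auto
  then have "Idl (insert (b 0) ?T) = carrier R"
    by (rule T.one_imp_carrier)
  moreover have "finite ?T"
    by (simp add: S_def)
  ultimately obtain u' where u': "u' \<in> Idl ?T" "unit_mod R J (b 0 \<oplus> u')"
    using unital_set_conditionD[OF usc b0, of ?T] b1 e S by auto
  have "u' \<in> PIdl e <+> (PIdl (b 1) <+> Idl S)"
    using u'(1) b1 e S by (simp add: genideal_insert)
  then obtain s r c where src: "s \<in> carrier R" "r \<in> carrier R" "c \<in> Idl S"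
    and u'_eq: "u' = s \<otimes> e \<oplus> (r \<otimes> b 1 \<oplus> c)"
    by (auto elim!: set_addE simp: cgenideal_def)
  have c: "c \<in> carrier R"
    using src(3) ideal.Icarr[OF genideal_ideal[OF S]] by blast
  obtain v where v: "v \<in> carrier R" "(b 0 \<oplus> u') \<otimes> v \<ominus> \<one> \<in> J"
    using u'(2) unit_mod_iff[OF J] by blast
  define u where "u = b 0 \<oplus> (r \<otimes> b 1 \<oplus> c)"
  have u: "u \<in> carrier R"
    using b0 b1 src c by (simp add: u_def)
  define t where "t = \<one> \<ominus> u \<otimes> v"
  \<comment> \<open>\<open>u\<close> arises from \<open>b 0 \<oplus> u'\<close> by dropping the
    summand \<open>s \<otimes> e\<close>, which lies in \<open>J\<close>. Hence \<open>v\<close>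
    inverts \<open>u\<close> modulo \<open>J\<close> too, and now \<open>u\<close> is a combination
    of the entries of \<open>b\<close> alone.\<close>
  have t_eq: "t = s \<otimes> v \<otimes> e \<ominus> ((b 0 \<oplus> u') \<otimes> v \<ominus> \<one>)"
    unfolding t_def u_def u'_eq using b0 b1 src c v(1) e by algebra
  have tJ: "t \<in> J"
    unfolding t_eq using v ge(2) src
    by (simp add: a_minus_def J.a_closed J.I_l_closed J.a_inv_closed)
  then have t: "t \<in> carrier R"
    by simp
  define b1' where "b1' = b 1 \<oplus> (\<one> \<ominus> b 1) \<otimes> t"
  have b1': "b1' \<in> carrier R"
    using b1 t by (simp add: b1'_def)
  define a0 where "a0 = b 0 \<ominus> r \<otimes> ((\<one> \<ominus> b 1) \<otimes> t)"
  have a0: "a0 \<in> carrier R"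
    using b0 b1 t src by (simp add: a0_def)
  define a where "a = (\<lambda>i\<in>{0..l}. if i = 0 then a0 else if i = 1 then b1' else b i)"
  have "a ` {0..l} = insert (a 0) (insert (a 1) (a ` {2..l}))"
    using \<open>{0..l} = insert 0 (insert 1 {2..l})\<close> by (metis image_insert)
  moreover have "a ` {2..l} = S"
    unfolding S_def a_def by (intro image_cong) auto
  ultimately have img_a: "a ` {0..l} = insert a0 (insert b1' S)"
    using l by (simp add: a_def)
  have K: "ideal (Idl (a ` {0..l})) R" and K_sup: "insert a0 (insert b1' S) \<subseteq> Idl (a ` {0..l})"
    unfolding img_a
    using genideal_ideal[of "insert a0 (insert b1' S)"] genideal_self[of "insert a0 (insert b1' S)"]
      a0 b1' S by auto
  interpret K: ideal "Idl (a ` {0..l})" R by (fact K)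
  have "c \<in> Idl (a ` {0..l})"
    using src(3) genideal_minimal[OF K, of S] K_sup by blast
  then have "a0 \<oplus> r \<otimes> b1' \<oplus> c \<in> Idl (a ` {0..l})"
    using K_sup src by (intro K.a_closed K.I_l_closed) auto
  moreover have "a0 \<oplus> r \<otimes> b1' \<oplus> c = u"
    unfolding a0_def b1'_def u_def using b0 b1 t src c by algebra
  ultimately have uK: "u \<in> Idl (a ` {0..l})"
    by simp
  have "\<one> = b1' \<oplus> ((\<one> \<ominus> b 1) \<otimes> v) \<otimes> u"
    unfolding b1'_def t_def using b1 u v(1) by algebra
  moreover have "b1' \<oplus> ((\<one> \<ominus> b 1) \<otimes> v) \<otimes> u \<in> Idl (a ` {0..l})"
    using K_sup uK b1 v(1) by (intro K.a_closed K.I_l_closed) auto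
  ultimately have "Idl (a ` {0..l}) = carrier R"
    using K.one_imp_carrier by simp
  moreover have "a \<in> {0..l} \<rightarrow>\<^sub>E carrier R"
    using a0 b1' b by (auto simp: a_def)
  ultimately have "a \<in> GCD_tuples R l"
    by (simp add: GCD_tuples_iff)
  moreover have "J +> a i = J +> b i" if i: "i \<in> {0..l}" for i
  proof -
    have "a0 \<ominus> b 0 = (\<ominus> (r \<otimes> (\<one> \<ominus> b 1))) \<otimes> t"
      unfolding a0_def using b0 b1 t src by algebra
    then have "a0 \<ominus> b 0 \<in> J"
      using J.I_l_closed[OF tJ] b1 src by simp
    moreover have "b1' \<ominus> b 1 = (\<one> \<ominus> b 1) \<otimes> t"
      unfolding b1'_def using b1 t by algebra
    then have "b1' \<ominus> b 1 \<in> J"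
      using J.I_l_closed[OF tJ] b1 by simp
    ultimately have "J +> a0 = J +> b 0" "J +> b1' = J +> b 1"
      using quotient_eq_iff_same_a_r_cos[OF J] a0 b0 b1 b1' by auto
    then show ?thesis
      using i by (auto simp: a_def)
  qed
  ultimately show ?thesis
    by blast
qed

section \<open>Comparing classes modulo a product with classes modulo its factors\<close>

text \<open>The same scalar and inverse work modulo the larger ideal. This makes the reduction map
  independent of representatives.\<close>

lemma PF_rel_mono:
  assumes "ideal J R" "ideal K R" "J \<subseteq> K"
  shows "PF_rel R J l m \<subseteq> PF_rel R K l m"
proof (rule subrelI)
  fix a b
  assume "(a, b) \<in> PF_rel R J l m"
  then show "(a, b) \<in> PF_rel R K l m"
    unfolding PF_rel_iff[OF assms(1)] PF_rel_iff[OF assms(2)] using assms(3) by blast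
qed

lemma PF_rel_of_coset_eq:
  assumes "ideal J R" "a \<in> GCD_tuples R l" "b \<in> GCD_tuples R l"
    and "\<And>i. i \<in> {0..l} \<Longrightarrow> J +> a i = J +> b i"
  shows "(a, b) \<in> PF_rel R J l m"
  unfolding PF_rel_iff_coset[OF assms(1)]
proof (intro conjI bexI[of _ \<one>])
  show "\<forall>i\<in>{0..l}. J +> a i = J +> \<one> [^] m i \<otimes> b i"
    using assms(4) GCD_tuples_closed[OF assms(3)] by simp
qed (use assms in simp_all)

text \<open>This is the injectivity of the reduction map. The scalars \<open>c j\<close> and their
  inverses \<open>d j\<close> are glued separately; the congruences for the glued elements hold
  modulo each \<open>I j\<close>, hence modulo the product, which is the intersection.\<close>

lemma PF_rel_finprodI:
  assumes "finite A" "A \<noteq> {}"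
    and I: "\<And>j. j \<in> A \<Longrightarrow> ideal (I j) R"
    and comax: "\<And>i j. i \<in> A \<Longrightarrow> j \<in> A \<Longrightarrow> i \<noteq> j \<Longrightarrow> I i <+> I j = carrier R"
    and rel: "\<And>j. j \<in> A \<Longrightarrow> (a, b) \<in> PF_rel R (I j) l m"
  shows "(a, b) \<in> PF_rel R (\<Otimes>\<^bsub>ideals_set R\<^esub>j\<in>A. I j) l m"
proof -
  let ?P = "\<Otimes>\<^bsub>ideals_set R\<^esub>j\<in>A. I j"
  have P: "ideal ?P R"
    using I by (rule ideal_finprod)
  \<comment> \<open>With \<open>A\<close> nonempty, at least one of the assumed relations supplies
    these memberships.\<close>
  have ab: "a \<in> GCD_tuples R l" "b \<in> GCD_tuples R l"
    using assms(2) rel PF_rel_iff[OF I] by blast+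
  have "\<exists>c d. c \<in> carrier R \<and> d \<in> carrier R \<and> I j +> c \<otimes> d = I j +> \<one> \<and>
      (\<forall>i\<in>{0..l}. I j +> a i = I j +> c [^] m i \<otimes> b i)" if j: "j \<in> A" for j
    using rel[OF j] unfolding PF_rel_iff_coset[OF I[OF j]] Bex_def by simp
  then obtain c d where cd_all: "\<And>j. j \<in> A \<Longrightarrow> c j \<in> carrier R \<and> d j \<in> carrier R \<and>
      I j +> c j \<otimes> d j = I j +> \<one> \<and> (\<forall>i\<in>{0..l}. I j +> a i = I j +> c j [^] m i \<otimes> b i)"
    by metis
  then have c: "\<And>j. j \<in> A \<Longrightarrow> c j \<in> carrier R"
    and d: "\<And>j. j \<in> A \<Longrightarrow> d j \<in> carrier R"
    and cd: "\<And>j. j \<in> A \<Longrightarrow> I j +> c j \<otimes> d j = I j +> \<one>"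
    and eq: "\<And>j i. j \<in> A \<Longrightarrow> i \<in> {0..l} \<Longrightarrow> I j +> a i = I j +> c j [^] m i \<otimes> b i"
    by simp_all
  obtain c' where c': "c' \<in> carrier R" "\<And>j. j \<in> A \<Longrightarrow> I j +> c' = I j +> c j"
    using chinese_remainder_finite[where A = A and I = I and x = c, OF assms(1) I comax c] by blast
  obtain d' where d': "d' \<in> carrier R" "\<And>j. j \<in> A \<Longrightarrow> I j +> d' = I j +> d j"
    using chinese_remainder_finite[where A = A and I = I and x = d, OF assms(1) I comax d] by blast
  have mem: "x \<in> ?P \<longleftrightarrow> x \<in> carrier R \<and> (\<forall>j\<in>A. x \<in> I j)" for x
    using assms(1) I comax by (rule mem_finprod_comaximal_iff)
  have "c' \<otimes> d' \<ominus> \<one> \<in> I j" if j: "j \<in> A" for j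
  proof -
    have "I j +> c' \<otimes> d' = I j +> c j \<otimes> d j"
      using j c' d' c d by (intro coset_mult_cong[OF I]) auto
    then show ?thesis
      using quotient_eq_iff_same_a_r_cos[OF I] cd j c'(1) d'(1) by simp
  qed
  moreover have "a i \<ominus> c' [^] m i \<otimes> b i \<in> I j" if j: "j \<in> A" and i: "i \<in> {0..l}" for i j
  proof -
    have carr: "a i \<in> carrier R" "b i \<in> carrier R"
      using ab i GCD_tuples_closed by auto
    have "I j +> c' [^] m i \<otimes> b i = I j +> c j [^] m i \<otimes> b i"
      using j c' c carr by (intro coset_mult_cong[OF I] coset_pow_cong[OF I]) auto
    then show ?thesis
      using quotient_eq_iff_same_a_r_cos[OF I] eq i j c'(1) carr by simp
  qed
  moreover have "a i \<ominus> c' [^] m i \<otimes> b i \<in> carrier R" if "i \<in> {0..l}" for i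
    using that ab GCD_tuples_closed c'(1) by simp
  ultimately have "c' \<otimes> d' \<ominus> \<one> \<in> ?P" "\<forall>i\<in>{0..l}. a i \<ominus> c' [^] m i \<otimes> b i \<in> ?P"
    using c'(1) d'(1) mem by auto
  then show ?thesis
    unfolding PF_rel_iff[OF P] using ab c'(1) d'(1) by blast
qed

text \<open>This is the surjectivity of the reduction map in terms of representatives. In the proper
  case the coordinates are glued first and the result is then lifted to a unital tuple; in the
  improper case all relations are total.\<close>

lemma PF_rel_finprod_surj:
  assumes "finite A" "l \<ge> 1"
    and I: "\<And>j. j \<in> A \<Longrightarrow> ideal (I j) R"
    and comax: "\<And>i j. i \<in> A \<Longrightarrow> j \<in> A \<Longrightarrow> i \<noteq> j \<Longrightarrow> I i <+> I j = carrier R"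
    and usc: "unital_set_condition R (\<Otimes>\<^bsub>ideals_set R\<^esub>j\<in>A. I j)
      \<or> (\<Otimes>\<^bsub>ideals_set R\<^esub>j\<in>A. I j) = carrier R"
    and x: "\<And>j. j \<in> A \<Longrightarrow> x j \<in> GCD_tuples R l"
  shows "\<exists>a\<in>GCD_tuples R l. \<forall>j\<in>A. (a, x j) \<in> PF_rel R (I j) l m"
proof -
  let ?P = "\<Otimes>\<^bsub>ideals_set R\<^esub>j\<in>A. I j"
  have P: "ideal ?P R"
    using I by (rule ideal_finprod)
  have mem: "x \<in> ?P \<longleftrightarrow> x \<in> carrier R \<and> (\<forall>j\<in>A. x \<in> I j)" for x
    using assms(1) I comax by (rule mem_finprod_comaximal_iff)
  show ?thesis
    using usc
  proof
    assume "?P = carrier R"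
    then have IR: "I j = carrier R" if "j \<in> A" for j
      using mem that ideal.Icarr[OF I] by blast
    \<comment> \<open>Every \<open>I j\<close> contains the product and so equals
      \<open>carrier R\<close>; any unital tuple is then related to all the \<open>x j\<close>, and
      the constant tuple \<open>\<one>\<close> is one.\<close>
    define o1 where "o1 = (\<lambda>i\<in>{0..l}. \<one>)"
    have "o1 ` {0..l} = {\<one>}"
      by (auto simp: o1_def)
    then have "o1 \<in> GCD_tuples R l"
      by (auto simp: GCD_tuples_iff genideal_one) (auto simp: o1_def)
    then show ?thesis
      using x by (intro bexI[of _ o1]) (auto simp: PF_rel_def IR)
  next
    assume "unital_set_condition R ?P"
    have "\<forall>i\<in>{0..l}. \<exists>z\<in>carrier R. \<forall>j\<in>A. I j +> z = I j +> x j i"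
    proof
      fix i
      assume "i \<in> {0..l}"
      then show "\<exists>z\<in>carrier R. \<forall>j\<in>A. I j +> z = I j +> x j i"
        using chinese_remainder_finite[where A = A and I = I and x = "\<lambda>j. x j i", OF assms(1) I comax] GCD_tuples_closed[OF x]
        by blast
    qed
    then obtain b where b: "\<And>i. i \<in> {0..l} \<Longrightarrow> b i \<in> carrier R"
      and bx: "\<And>i j. i \<in> {0..l} \<Longrightarrow> j \<in> A \<Longrightarrow> I j +> b i = I j +> x j i"
      by metis
    let ?B = "Idl (b ` {0..l})"
    have b_sub: "b ` {0..l} \<subseteq> carrier R"
      using b by blast
    have B: "ideal ?B R" "b ` {0..l} \<subseteq> ?B"
      using genideal_ideal[OF b_sub] genideal_self[OF b_sub] by auto
    \<comment> \<open>Modulo \<open>I j\<close> the entries of \<open>b\<close> agree with those of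
      the unital tuple \<open>x j\<close>, so \<open>?B\<close> together with \<open>I j\<close>
      generates the ring. Comaximality with each factor then passes to the product.\<close>
    have "?B <+> I j = carrier R" if j: "j \<in> A" for j
    proof -
      have sum: "ideal (?B <+> I j) R"
        using add_ideals B(1) I j by blast
      have "x j i \<in> ?B <+> I j" if i: "i \<in> {0..l}" for i
      proof (rule set_addI)
        have carr: "b i \<in> carrier R" "x j i \<in> carrier R"
          using b i j GCD_tuples_closed[OF x] by auto
        show "b i \<in> ?B"
          using B(2) i by blast
        show "x j i \<ominus> b i \<in> I j"
          using quotient_eq_iff_same_a_r_cos[OF I] bx i j carr by simp
        show "x j i = b i \<oplus> (x j i \<ominus> b i)"
          using carr by algebra
      qed
      then have "Idl (x j ` {0..l}) \<subseteq> ?B <+> I j"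
        by (intro genideal_minimal sum) auto
      then show ?thesis
        using x[OF j] ideal.Icarr[OF sum] by (auto simp: GCD_tuples_iff)
    qed
    then have "?B <+> ?P = carrier R"
      using I by (intro comaximal_finprod assms(1) B(1)) auto
    then obtain a where a: "a \<in> GCD_tuples R l" "\<And>i. i \<in> {0..l} \<Longrightarrow> ?P +> a i = ?P +> b i"
      using lift_unital_tuple[where b = b, OF \<open>unital_set_condition R ?P\<close> assms(2) b] by blast
    have "(a, x j) \<in> PF_rel R (I j) l m" if j: "j \<in> A" for j
    proof (rule PF_rel_of_coset_eq[OF I[OF j] a(1) x[OF j]])
      fix i
      assume i: "i \<in> {0..l}"
      \<comment> \<open>The lift changes \<open>b\<close> only modulo the product, so the
        congruences with \<open>x j\<close> modulo \<open>I j\<close> survive.\<close>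
      have "?P \<subseteq> I j"
        using mem j by blast
      then have "I j +> a i = I j +> b i"
        using coset_eq_mono[OF P I[OF j]] a i b GCD_tuples_closed[OF a(1)] by blast
      then show "I j +> a i = I j +> x j i"
        using bx i j by simp
    qed
    then show ?thesis
      using a(1) by blast
  qed
qed

end

section \<open>Well-definedness and bijectivity of the reduction map\<close>

theorem theoremA:
  fixes R :: "('a, 'b) ring_scheme" (structure)
    and k l :: nat and m :: "nat \<Rightarrow> nat" and I :: "nat \<Rightarrow> 'a set"
  assumes "cring R"
    and "k \<ge> 1" and "l \<ge> 1"
    and "\<And>i. i \<in> {0..l} \<Longrightarrow> m i \<ge> 1"
    and "\<And>j. j \<in> {1..k} \<Longrightarrow> ideal (I j) R"
    and "\<And>i j. i \<in> {1..k} \<Longrightarrow> j \<in> {1..k} \<Longrightarrow> i \<noteq> j \<Longrightarrow> I i <+> I j = carrier R"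
    and "unital_set_condition R (ideal_product R I k) \<or> ideal_product R I k = carrier R"
  shows "(\<forall>a\<in>GCD_tuples R l.
            CRT_reduction R I k l m (PF_class R (ideal_product R I k) l m a)
              = (\<lambda>j\<in>{1..k}. PF_class R (I j) l m a))
       \<and> CRT_reduction R I k l m ` PF R (ideal_product R I k) l m
           = (\<Pi>\<^sub>E j\<in>{1..k}. PF R (I j) l m)
       \<and> bij_betw (CRT_reduction R I k l m)
           (PF R (ideal_product R I k) l m) (\<Pi>\<^sub>E j\<in>{1..k}. PF R (I j) l m)"
proof -
  interpret cring R by fact
  let ?G = "GCD_tuples R l" and ?A = "{1..k}"
  define P where "P = ideal_product R I k"
  define f where "f = CRT_reduction R I k l m"
  have P_eq: "P = (\<Otimes>\<^bsub>ideals_set R\<^esub>j\<in>?A. I j)"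
    by (simp add: P_def ideal_product_def)
  note I = assms(5) and comax = assms(6)
  have P: "ideal P R"
    unfolding P_eq by (rule ideal_finprod) (rule I)
  have PI: "P \<subseteq> I j" if "j \<in> ?A" for j
    using mem_finprod_comaximal_iff[of ?A I, OF _ I comax] that unfolding P_eq by blast
  note eqP = equiv_PF_rel[OF P, of l m]
  have PF_img: "PF R J l m = PF_class R J l m ` ?G" for J
    unfolding PF_def PF_class_def quotient_def by blast
  have class_eq_iff: "PF_class R J l m a = PF_class R J l m b \<longleftrightarrow> (a, b) \<in> PF_rel R J l m"
    if "ideal J R" "a \<in> ?G" "b \<in> ?G" for J a b
    unfolding PF_class_def using eq_equiv_class_iff[OF equiv_PF_rel[OF that(1)] that(2,3)] .
  have f_class: "f (PF_class R P l m a) = (\<lambda>j\<in>?A. PF_class R (I j) l m a)" if a: "a \<in> ?G" for a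
  proof -
    \<comment> \<open>All representatives of a class modulo \<open>P\<close> have the same class
      modulo \<open>I j\<close>, so the image is a singleton and \<open>the_elem\<close> returns its
      element.\<close>
    have "PF_class R (I j) l m ` PF_class R P l m a = {PF_class R (I j) l m a}" if j: "j \<in> ?A" for j
    proof -
      have "PF_class R (I j) l m b = PF_class R (I j) l m a" if "b \<in> PF_class R P l m a" for b
      proof -
        have "(a, b) \<in> PF_rel R (I j) l m" "b \<in> ?G"
          using that PF_rel_mono[OF P I[OF j] PI[OF j]] PF_rel_iff[OF P]
          unfolding PF_class_def by blast+
        then show ?thesis
          using class_eq_iff[OF I[OF j]] a by metis
      qed
      moreover have "a \<in> PF_class R P l m a"
        unfolding PF_class_def using equiv_class_self[OF eqP a] .
      ultimately show ?thesis
        by blast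
    qed
    then show ?thesis
      using a unfolding f_def CRT_reduction_def P_def[symmetric] PF_img by (auto intro!: restrict_ext)
  qed
  have img: "f ` PF R P l m = (\<Pi>\<^sub>E j\<in>?A. PF R (I j) l m)"
  proof (intro equalityI subsetI)
    fix F
    assume "F \<in> f ` PF R P l m"
    then show "F \<in> (\<Pi>\<^sub>E j\<in>?A. PF R (I j) l m)"
      unfolding PF_img using f_class by auto
  next
    fix F
    assume F: "F \<in> (\<Pi>\<^sub>E j\<in>?A. PF R (I j) l m)"
    then have "\<forall>j\<in>?A. \<exists>x\<in>?G. F j = PF_class R (I j) l m x"
      unfolding PF_img by (auto dest: PiE_mem)
    then obtain x where x: "\<And>j. j \<in> ?A \<Longrightarrow> x j \<in> ?G"
      and Fx: "\<And>j. j \<in> ?A \<Longrightarrow> F j = PF_class R (I j) l m (x j)"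
      by metis
    obtain a where a: "a \<in> ?G" "\<And>j. j \<in> ?A \<Longrightarrow> (a, x j) \<in> PF_rel R (I j) l m"
      using PF_rel_finprod_surj[where A = ?A and l = l and I = I and x = x and m = m,
          OF _ assms(3) I comax _ x] assms(7)
      unfolding P_def[symmetric] P_eq by blast
    \<comment> \<open>Both sides are extensional on \<open>?A\<close>, so comparing them at each
      \<open>j\<close> suffices.\<close>
    have "F = (\<lambda>j\<in>?A. PF_class R (I j) l m a)"
    proof (rule PiE_ext[OF F])
      fix j
      assume j: "j \<in> ?A"
      then show "F j = (\<lambda>j\<in>?A. PF_class R (I j) l m a) j"
        using Fx[OF j] class_eq_iff[OF I[OF j] a(1) x[OF j]] a(2)[OF j] by simp
    qed (use a(1) in \<open>auto simp: PF_img\<close>)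
    then show "F \<in> f ` PF R P l m"
      unfolding PF_img image_image using f_class[OF a(1)] a(1) by (metis image_eqI)
  qed
  have "inj_on f (PF R P l m)"
  proof (rule inj_onI)
    fix C D
    assume "C \<in> PF R P l m" "D \<in> PF R P l m" and eq: "f C = f D"
    then obtain a b where ab: "a \<in> ?G" "b \<in> ?G"
      and CD: "C = PF_class R P l m a" "D = PF_class R P l m b"
      unfolding PF_img by blast
    have "(a, b) \<in> PF_rel R (I j) l m" if "j \<in> ?A" for j
      using fun_cong[OF eq, of j] that class_eq_iff[OF I[OF that] ab] unfolding CD
      by (simp add: f_class[OF ab(1)] f_class[OF ab(2)])
    then have "(a, b) \<in> PF_rel R P l m"
      \<comment> \<open>Here \<open>k \<ge> 1\<close> makes the index set nonempty, as the gluing of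
        the scalars demands.\<close>
      unfolding P_eq using assms(2) I comax by (intro PF_rel_finprodI) auto
    then show "C = D"
      using class_eq_iff[OF P] ab CD by simp
  qed
  then show ?thesis
    using f_class img unfolding f_def P_def bij_betw_def by blast
qed

end
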